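(* Let $P$ be a probability distribution on $\mathbb{R}^d$ with $P(\mathbb{R}^d\setminus\{0\})>0$. ($\mathbf{D}'_1$, rotational invariance) For every orthogonal matrix $O\in\mathbb{R}^{d\times d}$ and every $x\ne0$, $\mathrm{pD}(x;P)=\mathrm{pD}(Ox;O_\#P)$. ($\mathbf{D}_3$, monotonicity along rays through $0$) For every $x\neq0$: $\mathrm{pD}(tx;P)\le\mathrm{pD}(x;P)$ for all $t\ge1$, and $\mathrm{pD}(x;P)\le\mathrm{pD}(tx;P)$ for all $0<t\le1$. If in addition $P(\partial H_{0,u})=0$ for all $u\in\mathbb{S}$, then for every $x\ne 0$ and every sequence $(t_n)$ of positive numbers with $t_n\to0$, $\lim_{n\to\infty}\mathrm{pD}(t_nx;P)=P_r((0,\infty))\,\mathrm{aD}(\theta(x);P_{\theta|0})$. ($\mathbf{D}_4$, vanishing at infinity) $\mathrm{pD}(x;P)\to0$ as $\|x\|\to+\infty$. ($\mathbf{D}_5$, upper semicontinuity) If the radial distribution $P_r$ is continuous, then $\mathrm{pD}(\cdot;P)$ is upper semicontinuous: if $x_n\to x\ne0$, then $\limsup_n\mathrm{pD}(x_n;P)\le\mathrm{pD}(x;P)$. If additionally $P(\partial H_{0,u})=0$ for all $u\in\mathbb{S}$, then $x\mapsto\mathrm{pD}(x;P)$ is continuous on $\mathbb{R}^d\setminus\{0\}$. ($\mathbf{D}_6$, continuity in measure) Suppose that $P$ places no mass on the boundary of any affine halfspace of $\mathbb{R}^d$ and that $P_r$ is continuous. Then for every sequence $(\pi_n)$ of probability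 measures on $\mathbb{R}^d$ converging weakly to $P$, $\sup_{x\ne0}|\mathrm{pD}(x;P)-\mathrm{pD}(x;\pi_n)|\to0$ as $n\to\infty$.
   Context: Let $d\ge2$, let $\langle\cdot,\cdot\rangle$ and $\|\cdot\|$ be the Euclidean inner product and norm on $\mathbb{R}^d$, and $\mathbb{S}=\{z\in\mathbb{R}^d:\|z\|=1\}$. For $x\ne0$ put $r(x)=\|x\|$ and $\theta(x)=x/\|x\|$. For $u\in\mathbb{S}$ let $H_{0,u}=\{y:\langle y,u\rangle\ge0\}$ and $\partial H_{0,u}=\{y:\langle y,u\rangle=0\}$. $f_\#P$ denotes push-forward. Polar depth: for $x\ne0$ and a probability measure $P$ on $\mathbb{R}^d$, $\mathrm{pD}(x;P)=\inf\{P(\{y:\|y\|\ge\|x\|,\ y\in H_{0,u}\}):u\in\mathbb{S},\ x\in H_{0,u}\}$. Angular halfspace depth: for a probability measure $Q$ on $\mathbb{S}$ and $w\in\mathbb{S}$, $\mathrm{aD}(w;Q)=\inf\{Q(\mathbb{S}\cap H_{0,u}):u\in\mathbb{S},\,w\in H_{0,u}\}$. $P_r$ is the push-forward of $P$ by $y\mapsto\|y\|$; "continuous" means it has no atoms. $P_{\theta|0}$ is the probability measure on $\mathbb{S}$ given by $P_{\theta|0}(A)=P\{y\ne0:\theta(y)\in A\}/P(\mathbb{R}^d\setminus\{0\})$. *)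

theory Defs
  imports "HOL-Probability.Probability"
begin

definition halfspace0 :: "'a::euclidean_space \<Rightarrow> 'a set" where
  "halfspace0 u = {y. y \<bullet> u \<ge> 0}"

definition hyperplane0 :: "'a::euclidean_space \<Rightarrow> 'a set" where
  "hyperplane0 u = {y. y \<bullet> u = 0}"

definition direction :: "'a::euclidean_space \<Rightarrow> 'a" where
  "direction x = x /\<^sub>R norm x"

text \<open>Meaningful only for \<open>x \<noteq> 0\<close>; the value at the origin is never used.\<close>

definition polar_depth :: "'a::euclidean_space \<Rightarrow> 'a measure \<Rightarrow> real" where
  "polar_depth x P =
     (INF u \<in> {u \<in> sphere 0 1. x \<in> halfspace0 u}.
        measure P {y. norm y \<ge> norm x \<and> y \<in> halfspace0 u})"

definition angular_depth :: "'a::euclidean_space \<Rightarrow> 'a measure \<Rightarrow> real" where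
  "angular_depth w Q =
     (INF u \<in> {u \<in> sphere 0 1. w \<in> halfspace0 u}.
        measure Q (sphere 0 1 \<inter> halfspace0 u))"

definition radial_distr :: "'a::euclidean_space measure \<Rightarrow> real measure" where
  "radial_distr P = distr P borel norm"

definition atomless :: "real measure \<Rightarrow> bool" where
  "atomless \<mu> \<longleftrightarrow> (\<forall>r. measure \<mu> {r} = 0)"

text \<open>
  The law of the direction under \<open>P\<close> conditioned on \<open>y \<noteq> 0\<close>, as a measure on the Borel sets of
  the unit sphere. The lemma below gives it as a quotient of \<open>P\<close>-probabilities.
\<close>

definition angular_distr :: "'a::euclidean_space measure \<Rightarrow> 'a measure" where
  "angular_distr P =
     distr (uniform_measure (restrict_space P (- {0})) (- {0}))
           (restrict_space borel (sphere 0 1)) direction"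

lemma direction_measurable:
  assumes "sets P = sets borel"
  shows "direction \<in> measurable (restrict_space P (- {0})) (restrict_space borel (sphere 0 1))"
proof (rule measurable_restrict_space2)
  show "direction \<in> space (restrict_space P (- {0})) \<rightarrow> sphere 0 1"
    by (auto simp: space_restrict_space direction_def)
  have "direction \<in> borel_measurable P"
    unfolding direction_def[abs_def] measurable_cong_sets[OF assms refl] by measurable
  then show "direction \<in> borel_measurable (restrict_space P (- {0}))"
    by (rule measurable_restrict_space1)
qed

lemma measure_angular_distr:
  assumes P: "prob_space P" "sets P = sets borel" "measure P (- {0}) > 0"
    and A: "A \<in> sets borel" "A \<subseteq> sphere 0 1"
  shows "measure (angular_distr P) A = measure P {y. y \<noteq> 0 \<and> direction y \<in> A} / measure P (- {0})"
    and "prob_space (angular_distr P)"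
proof -
  interpret prob_space P by fact
  let ?R = "restrict_space P (- {0::'a})"
  have S: "- {0} \<inter> space P \<in> sets P" "space P = UNIV"
    using P(2) sets_eq_imp_space_eq[OF P(2)] by auto
  have R: "space ?R = - {0}" "- {0} \<in> sets ?R"
    using S sets.top[of ?R] by (auto simp: space_restrict_space)
  have mP: "emeasure ?R B = emeasure P B" if "B \<subseteq> - {0}" for B
    using that S by (intro emeasure_restrict_space) auto
  have pos: "emeasure ?R (- {0}) \<noteq> 0" "emeasure ?R (- {0}) \<noteq> \<infinity>"
    using P(3) by (auto simp: mP emeasure_eq_measure)
  have meas: "direction \<in> measurable (uniform_measure ?R (- {0})) (restrict_space borel (sphere 0 1))"
    using direction_measurable[OF P(2)] by simp
  show "prob_space (angular_distr P)"
    unfolding angular_distr_def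
    by (intro prob_space.prob_space_distr prob_space_uniform_measure pos meas)
  have A': "A \<in> sets (restrict_space borel (sphere 0 1))"
    using A by (auto simp: sets_restrict_space)
  have pre: "direction -` A \<inter> space ?R \<in> sets ?R"
    using direction_measurable[OF P(2)] A' by (rule measurable_sets)
  have eq: "direction -` A \<inter> space ?R = {y. y \<noteq> 0 \<and> direction y \<in> A}"
    by (auto simp: R)
  have "measure (angular_distr P) A
      = measure (uniform_measure ?R (- {0})) (direction -` A \<inter> space ?R)"
    unfolding angular_distr_def using meas A' by (simp add: measure_distr)
  also have "\<dots> = measure ?R (- {0} \<inter> (direction -` A \<inter> space ?R)) / measure ?R (- {0})"
    using pos pre by (intro measure_uniform_measure)
  also have "- {0} \<inter> (direction -` A \<inter> space ?R) = {y. y \<noteq> 0 \<and> direction y \<in> A}"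
    using eq R by auto
  finally show "measure (angular_distr P) A
      = measure P {y. y \<noteq> 0 \<and> direction y \<in> A} / measure P (- {0})"
    by (simp add: measure_def mP subset_eq)
qed

text \<open>The weak convergence of the library is defined by distribution functions on the real line only.\<close>

definition weakly_converges ::
  "(nat \<Rightarrow> 'a::euclidean_space measure) \<Rightarrow> 'a measure \<Rightarrow> bool" where
  "weakly_converges \<pi> P \<longleftrightarrow>
     (\<forall>f :: 'a \<Rightarrow> real. continuous_on UNIV f \<and> bounded (range f) \<longrightarrow>
        (\<lambda>n. integral\<^sup>L (\<pi> n) f) \<longlonglongrightarrow> integral\<^sup>L P f)"

end

theory Submission
  imports Defs
begin

text \<open>
  The regions in the definition of the polar depth are written as superlevel sets
  \<open>{y. 0 \<le> G p y}\<close> of bounded continuous functions whose dependence on the parameter \<open>p\<close>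
  is 1-Lipschitz uniformly in \<open>y\<close>. Replacing the radius \<open>r\<close> by \<open>1 / (1 + r)\<close> makes the
  parameter space \<open>[0, 1] \<times> sphere\<close> compact, so weak convergence, which gives joint
  convergence in the measure and the parameter, gives uniform convergence without a
  separate tightness argument. The continuity statements are the case of a constant sequence
  of measures; there the set of admissible directions varies with the point, but only by
  a Hausdorff distance controlled by the displacement of the point.
\<close>

section \<open>Infima, and masses of superlevel sets under weak convergence\<close>

text \<open>Passes a pointwise error on to infima. Real infima behave well only over nonempty
  families bounded below, whence the first two premises.\<close>

lemma INF_le_INF_add:
  fixes f :: "'a \<Rightarrow> real" and g :: "'b \<Rightarrow> real"
  assumes "A \<noteq> {}" "bdd_below (g ` B)" "\<And>a. a \<in> A \<Longrightarrow> \<exists>b\<in>B. g b \<le> f a + e"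
  shows "(INF b\<in>B. g b) \<le> (INF a\<in>A. f a) + e"
proof -
  have "(INF b\<in>B. g b) - e \<le> (INF a\<in>A. f a)"
  proof (rule cINF_greatest[OF assms(1)])
    fix a assume "a \<in> A"
    then obtain b where "b \<in> B" "g b \<le> f a + e" using assms(3) by blast
    then show "(INF b\<in>B. g b) - e \<le> f a"
      using cINF_lower[OF assms(2) \<open>b \<in> B\<close>] by linarith
  qed
  then show ?thesis by linarith
qed

text \<open>If \<open>k * dist q p \<le> 1\<close>, then the ramp \<open>max 0 (min 1 (2 + k * G p y))\<close> equals 1 wherever
  \<open>G q\<close> is nonnegative; as \<open>k\<close> grows, it decreases to the indicator of \<open>{y. 0 \<le> G p y}\<close>.\<close>

lemma eventually_measure_superlevel_less:
  fixes G :: "'p::metric_space \<Rightarrow> 'a::euclidean_space \<Rightarrow> real"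
  assumes \<pi>: "\<And>n. prob_space (\<pi> n)" "\<And>n. sets (\<pi> n) = sets borel"
    and P: "prob_space P" "sets P = sets borel"
    and weak: "weakly_converges \<pi> P"
    and cont: "\<And>p. continuous_on UNIV (G p)"
    and lip: "\<And>p q y. \<bar>G p y - G q y\<bar> \<le> dist p q"
    and e: "e > 0"
  shows "\<forall>\<^sub>F (n, q) in sequentially \<times>\<^sub>F nhds p.
           measure (\<pi> n) {y. 0 \<le> G q y} < measure P {y. 0 \<le> G p y} + e"
proof -
  define \<phi> where "\<phi> k y = max 0 (min 1 (2 + real k * G p y))" for k y
  have \<phi>_cont: "continuous_on UNIV (\<phi> k)" for k
    unfolding \<phi>_def[abs_def] by (intro continuous_intros cont)
  have \<phi>_meas: "\<phi> k \<in> borel_measurable borel" for k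
    by (rule borel_measurable_continuous_onI[OF \<phi>_cont])
  have \<phi>_bounds: "0 \<le> \<phi> k y" "\<phi> k y \<le> 1" for k y by (auto simp: \<phi>_def)
  have closed: "closed {y. 0 \<le> G q y}" for q
    by (intro closed_Collect_le continuous_intros cont)
  interpret P: prob_space P by (rule P)
  have "(\<lambda>k. integral\<^sup>L P (\<phi> k)) \<longlonglongrightarrow> integral\<^sup>L P (indicator {y. 0 \<le> G p y})"
  proof (rule integral_dominated_convergence[where w="\<lambda>_. 1"])
    show "AE y in P. (\<lambda>k. \<phi> k y) \<longlonglongrightarrow> indicator {y. 0 \<le> G p y} y"
    proof (rule AE_I2)
      fix y
      show "(\<lambda>k. \<phi> k y) \<longlonglongrightarrow> indicator {y. 0 \<le> G p y} y"
      proof (cases "0 \<le> G p y")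
        case True
        then have "\<phi> k y = 1" for k by (simp add: \<phi>_def add_increasing2)
        then show ?thesis using True by simp
      next
        case False
        obtain N :: nat where N: "2 / - G p y < real N" using reals_Archimedean2 by blast
        have "\<phi> k y = 0" if "k \<ge> N" for k
        proof -
          have "2 / - G p y < real k" using N that by linarith
          then have "2 < real k * - G p y" using False by (simp only: pos_divide_less_eq)
          then show ?thesis by (simp add: \<phi>_def)
        qed
        then have "\<forall>\<^sub>F k in sequentially. \<phi> k y = 0" by (auto simp: eventually_sequentially)
        then show ?thesis using False by (simp add: tendsto_eventually)
      qed
    qed
  qed (use \<phi>_meas \<phi>_bounds closed in \<open>auto simp: measurable_cong_sets[OF P(2) refl] borel_closed P(2)\<close>)
  then have "(\<lambda>k. integral\<^sup>L P (\<phi> k)) \<longlonglongrightarrow> measure P {y. 0 \<le> G p y}"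
    by (simp add: P(2) sets_eq_imp_space_eq[OF P(2)])
  \<comment> \<open>A single ramp is fixed here: its \<open>P\<close>-integral is already below the
    target, and it dominates the indicators for all \<open>q\<close> near \<open>p\<close> at
    once.\<close>
  from order_tendstoD(2)[OF this, of "measure P {y. 0 \<le> G p y} + e"] e
  obtain k where k: "integral\<^sup>L P (\<phi> k) < measure P {y. 0 \<le> G p y} + e"
    by (auto simp: eventually_sequentially)
  have "bounded (range (\<phi> k))"
    unfolding bounded_iff using \<phi>_bounds by (intro exI[of _ 1]) auto
  then have "(\<lambda>n. integral\<^sup>L (\<pi> n) (\<phi> k)) \<longlonglongrightarrow> integral\<^sup>L P (\<phi> k)"
    using weak \<phi>_cont unfolding weakly_converges_def by blast
  then have 1: "\<forall>\<^sub>F n in sequentially. integral\<^sup>L (\<pi> n) (\<phi> k) < measure P {y. 0 \<le> G p y} + e"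
    using k by (rule order_tendstoD)
  \<comment> \<open>The radius is \<open>1 / (k + 1)\<close> rather than \<open>1 / k\<close> so
    that \<open>k = 0\<close> is covered.\<close>
  have 2: "\<forall>\<^sub>F q in nhds p. dist q p < 1 / (real k + 1)"
    by (rule eventually_nhds_metric[THEN iffD2]) (auto intro!: exI[of _ "1 / (real k + 1)"])
  have le: "measure (\<pi> n) {y. 0 \<le> G q y} \<le> integral\<^sup>L (\<pi> n) (\<phi> k)"
    if q: "dist q p < 1 / (real k + 1)" for n q
  proof -
    interpret prob_space "\<pi> n" by (rule \<pi>)
    have "integral\<^sup>L (\<pi> n) (indicator {y. 0 \<le> G q y}) \<le> integral\<^sup>L (\<pi> n) (\<phi> k)"
    proof (rule integral_mono)
      show "integrable (\<pi> n) (indicator {y. 0 \<le> G q y} :: _ \<Rightarrow> real)"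
        using closed[of q] by (intro integrable_const_bound[where B=1])
          (auto simp: borel_closed \<pi>(2) intro!: borel_measurable_indicator split: split_indicator)
      show "integrable (\<pi> n) (\<phi> k)"
        using \<phi>_meas \<phi>_bounds by (intro integrable_const_bound[where B=1])
          (auto simp: measurable_cong_sets[OF \<pi>(2) refl])
      fix y
      have "\<phi> k y = 1" if "0 \<le> G q y"
      proof -
        have "- G p y \<le> 1 / (real k + 1)" using lip[of q y p] q that by linarith
        then have "- G p y * (real k + 1) \<le> 1" by (simp add: pos_le_divide_eq)
        moreover have "real k * G p y \<ge> -1"
        proof (cases "0 \<le> G p y")
          case True then show ?thesis by (smt (verit) mult_nonneg_nonneg of_nat_0_le_iff)
        next
          case False
          with \<open>- G p y * (real k + 1) \<le> 1\<close> show ?thesis by (simp add: algebra_simps)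
        qed
        ultimately show ?thesis by (simp add: \<phi>_def)
      qed
      then show "indicator {y. 0 \<le> G q y} y \<le> \<phi> k y"
        using \<phi>_bounds by (auto split: split_indicator)
    qed
    then show ?thesis by (simp add: \<pi>(2) sets_eq_imp_space_eq[OF \<pi>(2)])
  qed
  have "\<forall>\<^sub>F z in sequentially \<times>\<^sub>F nhds p.
      integral\<^sup>L (\<pi> (fst z)) (\<phi> k) < measure P {y. 0 \<le> G p y} + e \<and> dist (snd z) p < 1 / (real k + 1)"
    using eventually_prodI[OF 1 2] by simp
  then show ?thesis
    by (rule eventually_mono) (auto simp: case_prod_beta intro: le_less_trans[OF le])
qed

text \<open>The one-sided bound is applied to \<open>G\<close> and to \<open>- G\<close>. The two
  superlevel sets cover the space, so an upper bound for one is a lower bound for the other, up to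
  the \<open>P\<close>-null set where \<open>G p\<close> vanishes.\<close>

lemma tendsto_measure_superlevel:
  fixes G :: "'p::metric_space \<Rightarrow> 'a::euclidean_space \<Rightarrow> real"
  assumes \<pi>: "\<And>n. prob_space (\<pi> n)" "\<And>n. sets (\<pi> n) = sets borel"
    and P: "prob_space P" "sets P = sets borel"
    and weak: "weakly_converges \<pi> P"
    and cont: "\<And>p. continuous_on UNIV (G p)"
    and lip: "\<And>p q y. \<bar>G p y - G q y\<bar> \<le> dist p q"
    and null: "measure P {y. G p y = 0} = 0"
  shows "((\<lambda>(n, q). measure (\<pi> n) {y. 0 \<le> G q y}) \<longlongrightarrow> measure P {y. 0 \<le> G p y})
           (sequentially \<times>\<^sub>F nhds p)"
proof (rule tendstoI)
  fix e :: real assume e: "e > 0"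
  have closed: "closed {y. 0 \<le> G q y}" "closed {y. 0 \<le> - G q y}" "closed {y. G q y = 0}" for q
    by (intro closed_Collect_le closed_Collect_eq continuous_intros cont)+
  \<comment> \<open>The first inequality serves \<open>\<pi> n\<close>, which may charge the zero
    set of \<open>G q\<close>; the second serves \<open>P\<close> at \<open>p\<close>, where the
    overlap is null.\<close>
  have total: "1 \<le> measure M {y. 0 \<le> G q y} + measure M {y. 0 \<le> - G q y}"
      "measure M {y. 0 \<le> G q y} + measure M {y. 0 \<le> - G q y} \<le> 1 + measure M {y. G q y = 0}"
    if "prob_space M" "sets M = sets borel" for M q
  proof -
    interpret prob_space M by fact
    have meas: "{y. 0 \<le> G q y} \<in> fmeasurable M" "{y. 0 \<le> - G q y} \<in> fmeasurable M"
      unfolding fmeasurable_eq_sets that(2) by (intro borel_closed closed)+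
    have U: "{y. 0 \<le> G q y} \<union> {y. 0 \<le> - G q y} = space M"
      using sets_eq_imp_space_eq[OF that(2)] by auto
    have I: "{y. 0 \<le> G q y} \<inter> {y. 0 \<le> - G q y} = {y. G q y = 0}" by auto
    have "measure M {y. 0 \<le> G q y} + measure M {y. 0 \<le> - G q y} = 1 + measure M {y. G q y = 0}"
      using measure_Un3[OF meas] unfolding U I prob_space by linarith
    then show "1 \<le> measure M {y. 0 \<le> G q y} + measure M {y. 0 \<le> - G q y}"
      "measure M {y. 0 \<le> G q y} + measure M {y. 0 \<le> - G q y} \<le> 1 + measure M {y. G q y = 0}"
      by auto
  qed
  have up: "\<forall>\<^sub>F (n, q) in sequentially \<times>\<^sub>F nhds p.
      measure (\<pi> n) {y. 0 \<le> G q y} < measure P {y. 0 \<le> G p y} + e"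
    by (rule eventually_measure_superlevel_less[OF \<pi> P weak cont lip e])
  have low: "\<forall>\<^sub>F (n, q) in sequentially \<times>\<^sub>F nhds p.
      measure (\<pi> n) {y. 0 \<le> - G q y} < measure P {y. 0 \<le> - G p y} + e"
  proof (rule eventually_measure_superlevel_less[OF \<pi> P weak _ _ e])
    show "continuous_on UNIV (\<lambda>y. - G q y)" for q by (intro continuous_intros cont)
    show "\<bar>- G q y - - G q' y\<bar> \<le> dist q q'" for q q' y using lip[of q y q'] by linarith
  qed
  show "\<forall>\<^sub>F z in sequentially \<times>\<^sub>F nhds p. dist (case z of (n, q) \<Rightarrow>
      measure (\<pi> n) {y. 0 \<le> G q y}) (measure P {y. 0 \<le> G p y}) < e"
    using up low
  proof eventually_elim
    case (elim z)
    then show ?case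
      using total(1)[OF \<pi>, of "fst z" "snd z"] total(2)[OF P, of p] null
      by (auto simp: dist_real_def case_prod_beta abs_less_iff)
  qed
qed

lemma weakly_converges_const: "weakly_converges (\<lambda>_. P) P"
  by (simp add: weakly_converges_def)

text \<open>A tube-lemma argument: each point of \<open>K\<close> has a rectangle on which
  \<open>Q\<close> holds, finitely many of their second factors cover \<open>K\<close>, and the
  finitely many matching events of \<open>F\<close> hold simultaneously.\<close>

lemma eventually_ball_compact:
  fixes Q :: "'b \<Rightarrow> 'p::topological_space \<Rightarrow> bool"
  assumes K: "compact K" and Q: "\<And>p. p \<in> K \<Longrightarrow> \<forall>\<^sub>F (n, q) in F \<times>\<^sub>F nhds p. Q n q"
  shows "\<forall>\<^sub>F n in F. \<forall>q\<in>K. Q n q"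
proof -
  have "\<exists>A U. eventually A F \<and> open U \<and> p \<in> U \<and> (\<forall>n q. A n \<longrightarrow> q \<in> U \<longrightarrow> Q n q)"
    if "p \<in> K" for p
    using Q[OF that] unfolding eventually_prod_filter eventually_nhds by (simp; blast)
  then obtain A U where AU: "\<And>p. p \<in> K \<Longrightarrow> eventually (A p) F" "\<And>p. p \<in> K \<Longrightarrow> open (U p)"
      "\<And>p. p \<in> K \<Longrightarrow> p \<in> U p" "\<And>p n q. p \<in> K \<Longrightarrow> A p n \<Longrightarrow> q \<in> U p \<Longrightarrow> Q n q"
    by metis
  obtain C where C: "C \<subseteq> K" "finite C" "K \<subseteq> (\<Union>p\<in>C. U p)"
    using K AU by (elim compactE_image[of K K U]) auto
  have "\<forall>\<^sub>F n in F. \<forall>p\<in>C. A p n"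
    using C AU by (intro eventually_ball_finite) auto
  then show ?thesis
    by (rule eventually_mono) (use C AU in blast)
qed

text \<open>This is the constant sequence of measures: nothing depends on \<open>n\<close>, so any
  large index can be inserted to leave only the neighbourhood filter.\<close>

lemma eventually_measure_superlevel_less_nhds:
  fixes G :: "'p::metric_space \<Rightarrow> 'a::euclidean_space \<Rightarrow> real"
  assumes P: "prob_space P" "sets P = sets borel"
    and cont: "\<And>p. continuous_on UNIV (G p)"
    and lip: "\<And>p q y. \<bar>G p y - G q y\<bar> \<le> dist p q"
    and e: "e > 0"
  shows "\<forall>\<^sub>F q in nhds p. measure P {y. 0 \<le> G q y} < measure P {y. 0 \<le> G p y} + e"
  using eventually_measure_superlevel_less[OF P P weakly_converges_const cont lip e, of p]
  by (auto simp: eventually_prod_filter eventually_sequentially elim!: eventually_mono)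

lemma continuous_on_measure_superlevel:
  fixes G :: "'p::metric_space \<Rightarrow> 'a::euclidean_space \<Rightarrow> real"
  assumes P: "prob_space P" "sets P = sets borel"
    and cont: "\<And>p. continuous_on UNIV (G p)"
    and lip: "\<And>p q y. \<bar>G p y - G q y\<bar> \<le> dist p q"
    and null: "\<And>p. p \<in> K \<Longrightarrow> measure P {y. G p y = 0} = 0"
  shows "continuous_on K (\<lambda>p. measure P {y. 0 \<le> G p y})"
proof -
  have "((\<lambda>q. measure P {y. 0 \<le> G q y}) \<longlongrightarrow> measure P {y. 0 \<le> G p y}) (nhds p)"
    if "p \<in> K" for p
  proof (rule tendstoI)
    fix e :: real assume "e > 0"
    from tendstoD[OF tendsto_measure_superlevel[OF P P weakly_converges_const cont lip
        null[OF that]] this]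
    show "\<forall>\<^sub>F q in nhds p. dist (measure P {y. 0 \<le> G q y}) (measure P {y. 0 \<le> G p y}) < e"
      by (auto simp: eventually_prod_filter eventually_sequentially elim!: eventually_mono)
  qed
  then show ?thesis
    unfolding continuous_on_def by (blast intro: tendsto_mono[OF at_within_le_nhds])
qed

text \<open>Near \<open>p\<close> and for large \<open>n\<close>, the masses under
  \<open>\<pi> n\<close> and under \<open>P\<close> at the same \<open>q\<close> both lie within
  \<open>e / 2\<close> of the \<open>P\<close>-mass at \<open>p\<close>. Compactness of
  \<open>K\<close> makes this uniform.\<close>

lemma uniform_measure_superlevel:
  fixes G :: "'p::metric_space \<Rightarrow> 'a::euclidean_space \<Rightarrow> real"
  assumes \<pi>: "\<And>n. prob_space (\<pi> n)" "\<And>n. sets (\<pi> n) = sets borel"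
    and P: "prob_space P" "sets P = sets borel"
    and weak: "weakly_converges \<pi> P"
    and cont: "\<And>p. continuous_on UNIV (G p)"
    and lip: "\<And>p q y. \<bar>G p y - G q y\<bar> \<le> dist p q"
    and K: "compact K"
    and null: "\<And>p. p \<in> K \<Longrightarrow> measure P {y. G p y = 0} = 0"
    and e: "e > 0"
  shows "\<forall>\<^sub>F n in sequentially. \<forall>p\<in>K.
           \<bar>measure (\<pi> n) {y. 0 \<le> G p y} - measure P {y. 0 \<le> G p y}\<bar> < e"
proof (rule eventually_ball_compact[OF K])
  fix p assume "p \<in> K"
  note null = null[OF this]
  show "\<forall>\<^sub>F (n, q) in sequentially \<times>\<^sub>F nhds p.
      \<bar>measure (\<pi> n) {y. 0 \<le> G q y} - measure P {y. 0 \<le> G q y}\<bar> < e"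
    using tendstoD[OF tendsto_measure_superlevel[OF \<pi> P weak cont lip null] half_gt_zero[OF e]]
      tendstoD[OF tendsto_measure_superlevel[OF P P weakly_converges_const cont lip null] half_gt_zero[OF e]]
  proof eventually_elim
    case (elim z)
    then show ?case
      unfolding dist_real_def case_prod_beta by (simp only: snd_conv fst_conv)
  qed
qed


section \<open>Polar regions as superlevel sets over a compact parameter space\<close>

text \<open>Dividing by \<open>1 + norm y\<close> keeps the sign of the inner product and makes the dependence on
  the direction 1-Lipschitz uniformly in \<open>y\<close>.\<close>

definition polar_gap :: "real \<times> 'a::euclidean_space \<Rightarrow> 'a \<Rightarrow> real" where
  "polar_gap p y = min (fst p - 1 / (1 + norm y)) ((y \<bullet> snd p) / (1 + norm y))"

definition polar_mass :: "'a::euclidean_space measure \<Rightarrow> real \<times> 'a \<Rightarrow> real" where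
  "polar_mass P p = measure P {y. 0 \<le> polar_gap p y}"

text \<open>The first coordinate stands for \<open>1 / (1 + r)\<close>. Its endpoint 0 represents
  infinite radius, where the region is empty; including it is what makes the space compact.\<close>

definition polar_params :: "(real \<times> 'a::euclidean_space) set" where
  "polar_params = {0..1} \<times> sphere 0 1"

definition outer_directions :: "'a::euclidean_space \<Rightarrow> 'a set" where
  "outer_directions x = {u \<in> sphere 0 1. x \<in> halfspace0 u}"

lemma norm_shift_pos [simp]: "0 < 1 + norm y" "1 + norm y \<noteq> 0"
  by (smt (verit) norm_ge_zero)+

lemma continuous_on_polar_gap: "continuous_on UNIV (polar_gap p)"
  unfolding polar_gap_def[abs_def] by (intro continuous_intros) simp_all

lemma polar_gap_lipschitz: "\<bar>polar_gap p y - polar_gap q y\<bar> \<le> dist p q"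
proof -
  have "\<bar>y \<bullet> snd p / (1 + norm y) - y \<bullet> snd q / (1 + norm y)\<bar>
      = \<bar>y \<bullet> (snd p - snd q)\<bar> / (1 + norm y)"
    by (simp add: inner_diff_right diff_divide_distrib[symmetric])
  also have "\<dots> \<le> norm y * norm (snd p - snd q) / (1 + norm y)"
    by (intro divide_right_mono Cauchy_Schwarz_ineq2) simp
  also have "\<dots> \<le> dist (snd p) (snd q)"
    by (simp add: dist_norm pos_divide_le_eq algebra_simps)
  also have "\<dots> \<le> dist p q" by (rule dist_snd_le)
  finally have "\<bar>y \<bullet> snd p / (1 + norm y) - y \<bullet> snd q / (1 + norm y)\<bar> \<le> dist p q" .
  moreover have "\<bar>fst p - fst q\<bar> \<le> dist p q"
    using dist_fst_le[of p q] by (simp add: dist_real_def)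
  ultimately show ?thesis unfolding polar_gap_def by linarith
qed

lemma polar_gap_nonneg_iff:
  "0 \<le> polar_gap (1 / (1 + norm x), u) y \<longleftrightarrow> norm x \<le> norm y \<and> y \<in> halfspace0 u"
proof -
  have "1 / (1 + norm y) \<le> 1 / (1 + norm x) \<longleftrightarrow> norm x \<le> norm y"
    by (simp add: divide_simps)
  moreover have "0 \<le> y \<bullet> u / (1 + norm y) \<longleftrightarrow> 0 \<le> y \<bullet> u"
    by (simp add: pos_le_divide_eq)
  ultimately show ?thesis
    by (simp add: polar_gap_def halfspace0_def)
qed

lemma polar_depth_altdef:
  "polar_depth x P = (INF u\<in>outer_directions x. polar_mass P (1 / (1 + norm x), u))"
  by (simp add: polar_depth_def polar_mass_def polar_gap_nonneg_iff outer_directions_def)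

lemma polar_mass_radius:
  "polar_mass P (1 / (1 + norm x), u) = measure P {y. norm x \<le> norm y \<and> y \<in> halfspace0 u}"
  by (simp add: polar_mass_def polar_gap_nonneg_iff)

lemma bdd_below_measure [simp]: "bdd_below ((\<lambda>i. measure M (S i)) ` I)"
  by (rule bdd_belowI2[of _ 0]) simp

lemma bdd_below_polar_mass [simp]: "bdd_below ((\<lambda>i. polar_mass P (p i)) ` I)"
  by (simp add: polar_mass_def)

lemma outer_directions_nonempty: "x \<noteq> 0 \<Longrightarrow> outer_directions x \<noteq> {}"
  by (auto simp: outer_directions_def halfspace0_def intro!: exI[of _ "direction x"])
     (auto simp: direction_def)

lemma outer_directions_scaleR: "t > 0 \<Longrightarrow> outer_directions (t *\<^sub>R x) = outer_directions x"
  by (auto simp: outer_directions_def halfspace0_def zero_le_mult_iff)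

lemma closed_polar_region: "closed {y. r \<le> norm y \<and> y \<in> halfspace0 u}"
proof -
  have "{y. r \<le> norm y \<and> y \<in> halfspace0 u} = {y. r \<le> norm y} \<inter> {y. 0 \<le> y \<bullet> u}"
    by (auto simp: halfspace0_def)
  then show ?thesis by (simp add: closed_Int closed_Collect_le continuous_on_inner continuous_on_norm)
qed

section \<open>Dependence of the admissible directions on the point\<close>

text \<open>Since \<open>x' \<bullet> u'\<close> is nonnegative, \<open>x \<bullet> u'\<close> is at
  least \<open>- dist x x'\<close>, and a tilt of length \<open>dist x x' / norm x\<close> repairs
  the sign. Renormalising moves the vector by at most the same length, whence the factor 2;
  \<open>dist x x' < norm x\<close> keeps the tilted vector away from 0.\<close>

lemma dist_outer_directions_le:
  fixes x x' u' :: "'a::euclidean_space"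
  assumes u': "u' \<in> outer_directions x'" and d: "dist x x' < norm x"
  shows "\<exists>u\<in>outer_directions x. dist u u' \<le> 2 * dist x x' / norm x"
proof -
  have x: "norm x > 0" using d by (smt (verit) zero_le_dist)
  have n: "norm u' = 1" "0 \<le> x' \<bullet> u'" using u' by (auto simp: outer_directions_def halfspace0_def)
  \<comment> \<open>Tilting \<open>u'\<close> towards \<open>x\<close> just enough to make the inner product with \<open>x\<close> nonnegative.\<close>
  define v where "v = u' + (dist x x' / (norm x)\<^sup>2) *\<^sub>R x"
  have "\<bar>(x - x') \<bullet> u'\<bar> \<le> dist x x'"
    using Cauchy_Schwarz_ineq2[of "x - x'" u'] n by (simp add: dist_norm)
  then have "x \<bullet> u' \<ge> - dist x x'" using n by (simp add: inner_diff_left)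
  moreover have "x \<bullet> v = x \<bullet> u' + dist x x'"
    using x by (simp add: v_def inner_add_right power2_norm_eq_inner)
  ultimately have xv: "x \<bullet> v \<ge> 0" by linarith
  have vu: "norm (v - u') = dist x x' / norm x"
    using x by (simp add: v_def power2_eq_square)
  have "norm (v - u') < 1" unfolding vu using x d by (simp add: pos_divide_less_eq)
  then have v: "norm v > 0" using n(1) norm_triangle_ineq2[of u' v] norm_minus_commute[of u' v] by linarith
  define u where "u = v /\<^sub>R norm v"
  have "u - v = (inverse (norm v) - 1) *\<^sub>R v" by (simp add: u_def algebra_simps)
  then have "norm (u - v) = \<bar>inverse (norm v) - 1\<bar> * norm v" by simp
  also have "\<dots> = \<bar>(inverse (norm v) - 1) * norm v\<bar>" by (simp add: abs_mult)
  also have "\<dots> = \<bar>norm u' - norm v\<bar>" using v n by (simp add: algebra_simps)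
  also have "\<dots> \<le> norm (v - u')" by (metis norm_minus_commute norm_triangle_ineq3)
  finally have "dist u u' \<le> 2 * dist x x' / norm x"
    using vu norm_triangle_ineq[of "u - v" "v - u'"] by (simp add: dist_norm)
  moreover have "u \<in> outer_directions x"
    using v xv by (simp add: outer_directions_def halfspace0_def u_def)
  ultimately show ?thesis by blast
qed

lemma inverse_shift_lipschitz:
  fixes a b :: real
  assumes "0 \<le> a" "0 \<le> b"
  shows "\<bar>1 / (1 + a) - 1 / (1 + b)\<bar> \<le> \<bar>a - b\<bar>"
proof -
  have "1 / (1 + a) - 1 / (1 + b) = (b - a) / ((1 + a) * (1 + b))"
    using assms by (simp add: divide_simps)
  then have "\<bar>1 / (1 + a) - 1 / (1 + b)\<bar> = \<bar>a - b\<bar> / ((1 + a) * (1 + b))"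
    using assms by (simp add: abs_mult abs_minus_commute)
  also have "\<dots> \<le> \<bar>a - b\<bar> / 1"
  proof (rule divide_left_mono)
    have "1 * 1 \<le> (1 + a) * (1 + b)" using assms by (intro mult_mono) auto
    then show "1 \<le> (1 + a) * (1 + b)" by simp
  qed (use assms in auto)
  finally show ?thesis by simp
qed

text \<open>An admissible direction at \<open>x\<close> is replaced by a nearby one admissible at
  \<open>x'\<close>. Half of \<open>\<delta>\<close> pays for the change of direction, half for the
  change of radius. The free bound \<open>c\<close> lets the lemma serve both semicontinuity and
  continuity.\<close>

lemma polar_depth_le_near:
  assumes u: "u \<in> outer_directions x" and x': "x' \<noteq> 0"
    and d: "dist x' x < norm x'" "2 * dist x' x / norm x' < \<delta> / 2" "dist x' x < \<delta> / 2"
    and near: "\<And>v. v \<in> outer_directions x' \<Longrightarrow> dist (1 / (1 + norm x'), v) (1 / (1 + norm x), u) < \<delta>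
      \<Longrightarrow> polar_mass P (1 / (1 + norm x'), v) \<le> c"
  shows "polar_depth x' P \<le> c"
proof -
  obtain v where v: "v \<in> outer_directions x'" "dist v u \<le> 2 * dist x' x / norm x'"
    using dist_outer_directions_le[OF u d(1)] by blast
  have "\<bar>1 / (1 + norm x') - 1 / (1 + norm x)\<bar> \<le> dist x' x"
    using inverse_shift_lipschitz[of "norm x'" "norm x"] norm_triangle_ineq3[of x' x]
    by (simp add: dist_norm)
  then have "dist (1 / (1 + norm x'), v) (1 / (1 + norm x), u) < \<delta>"
    using v d sqrt_sum_squares_le_sum_abs[of "dist (1 / (1 + norm x')) (1 / (1 + norm x))" "dist v u"]
    by (simp add: dist_Pair_Pair dist_real_def)
  from near[OF v(1) this] show ?thesis
    unfolding polar_depth_altdef by (intro cINF_lower2[OF _ v(1)]) auto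
qed

text \<open>The smallness conditions occur relative to \<open>norm x'\<close> and to
  \<open>norm x\<close>, because the continuity proof uses \<open>polar_depth_le_near\<close> in
  both directions.\<close>

lemma eventually_close_nonzero:
  assumes "x \<noteq> 0" "\<delta> > 0"
  shows "\<forall>\<^sub>F x' in nhds x. x' \<noteq> 0 \<and> dist x' x < norm x' \<and> 2 * dist x' x / norm x' < \<delta> / 2
    \<and> dist x' x < \<delta> / 2 \<and> dist x x' < norm x \<and> 2 * dist x x' / norm x < \<delta> / 2"
proof -
  have id: "((\<lambda>x'. x') \<longlongrightarrow> x) (nhds x)" by (rule filterlim_ident)
  \<comment> \<open>Each strict condition is written as positivity of a function that is continuous
    at \<open>x\<close> and positive there.\<close>
  have lim: "((\<lambda>x'. norm x' - dist x' x) \<longlongrightarrow> norm x - dist x x) (nhds x)"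
    "((\<lambda>x'. \<delta> / 2 - 2 * dist x' x / norm x') \<longlongrightarrow> \<delta> / 2 - 2 * dist x x / norm x) (nhds x)"
    "((\<lambda>x'. \<delta> / 2 - dist x' x) \<longlongrightarrow> \<delta> / 2 - dist x x) (nhds x)"
    "((\<lambda>x'. norm x - dist x x') \<longlongrightarrow> norm x - dist x x) (nhds x)"
    "((\<lambda>x'. \<delta> / 2 - 2 * dist x x' / norm x) \<longlongrightarrow> \<delta> / 2 - 2 * dist x x / norm x) (nhds x)"
    by (intro tendsto_intros id; use assms in simp)+
  have "\<forall>\<^sub>F x' in nhds x. x' \<noteq> 0" using assms(1) by (rule t1_space_nhds)
  then show ?thesis
    using order_tendstoD(1)[OF lim(1), of 0] order_tendstoD(1)[OF lim(2), of 0]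
      order_tendstoD(1)[OF lim(3), of 0] order_tendstoD(1)[OF lim(4), of 0]
      order_tendstoD(1)[OF lim(5), of 0] assms
    by (simp add: eventually_conj_iff)
qed

section \<open>Semicontinuity and continuity in the point\<close>

text \<open>One nearly optimal direction at \<open>x\<close> is followed to \<open>x'\<close>:
  \<open>e / 2\<close> covers its distance from the infimum, \<open>e / 2\<close> the local upper
  bound on \<open>polar_mass\<close>.\<close>

lemma polar_depth_upper_semicontinuous:
  assumes P: "prob_space P" "sets P = sets borel" and x: "x \<noteq> 0" and e: "e > 0"
  shows "\<forall>\<^sub>F x' in nhds x. polar_depth x' P \<le> polar_depth x P + e"
proof -
  have "polar_depth x P < polar_depth x P + e / 2" using e by simp
  then obtain u where u: "u \<in> outer_directions x"
      "polar_mass P (1 / (1 + norm x), u) < polar_depth x P + e / 2"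
    using outer_directions_nonempty[OF x]
    unfolding polar_depth_altdef[of x P] by (subst (asm) cINF_less_iff) auto
  obtain \<delta> where \<delta>: "\<delta> > 0" "\<And>q. dist q (1 / (1 + norm x), u) < \<delta> \<Longrightarrow>
      polar_mass P q < polar_mass P (1 / (1 + norm x), u) + e / 2"
    using eventually_measure_superlevel_less_nhds[OF P continuous_on_polar_gap
        polar_gap_lipschitz half_gt_zero[OF e], of "(1 / (1 + norm x), u)"]
    unfolding eventually_nhds_metric polar_mass_def by blast
  show ?thesis
    using eventually_close_nonzero[OF x \<delta>(1)]
  proof eventually_elim
    case (elim x')
    then show ?case
      using \<delta>(2) u(2) by (intro polar_depth_le_near[OF u(1), of x' \<delta>]) force+
  qed
qed

text \<open>A minimum vanishes only if one of its two terms does, so the zero set lies in the union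
  of a sphere about 0 and a hyperplane through 0.\<close>

lemma polar_gap_null:
  assumes P: "prob_space P" "sets P = sets borel" and rad: "atomless (radial_distr P)"
    and hyp: "\<And>u. u \<in> sphere 0 1 \<Longrightarrow> measure P (hyperplane0 u) = 0"
    and p: "p \<in> polar_params"
  shows "measure P {y. polar_gap p y = 0} = 0"
proof -
  interpret prob_space P by fact
  \<comment> \<open>For \<open>fst p = 0\<close>, division by zero gives \<open>r = - 1\<close>, so
    the sphere is empty, as it should be for infinite radius.\<close>
  define r where "r = 1 / fst p - 1"
  have sp: "space P = UNIV" using sets_eq_imp_space_eq[OF P(2)] by simp
  have "measure (radial_distr P) {r} = measure P (norm -` {r})"
    unfolding radial_distr_def by (subst measure_distr) (auto simp: sp measurable_cong_sets[OF P(2) refl])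
  then have 1: "measure P (norm -` {r}) = 0" using rad by (simp add: atomless_def)
  have 2: "measure P (hyperplane0 (snd p)) = 0"
    using p by (intro hyp) (auto simp: polar_params_def)
  have "closed (norm -` {r} :: 'a set)"
    using continuous_closed_vimage[of "{r}" "norm :: 'a \<Rightarrow> real"] by (simp add: continuous_at_imp_continuous_on)
  moreover have "closed (hyperplane0 (snd p))"
    unfolding hyperplane0_def
    by (intro closed_Collect_eq continuous_intros)
  ultimately have m: "norm -` {r} \<in> events" "hyperplane0 (snd p) \<in> events"
    by (simp_all add: P(2) borel_closed)
  have "{y. polar_gap p y = 0} \<subseteq> norm -` {r} \<union> hyperplane0 (snd p)"
  proof
    fix y assume "y \<in> {y. polar_gap p y = 0}"
    then have "fst p = 1 / (1 + norm y) \<or> y \<bullet> snd p = 0"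
      by (auto simp: polar_gap_def min_def split: if_splits)
    then show "y \<in> norm -` {r} \<union> hyperplane0 (snd p)"
      by (auto simp: r_def hyperplane0_def)
  qed
  then have "measure P {y. polar_gap p y = 0} \<le> measure P (norm -` {r} \<union> hyperplane0 (snd p))"
    using m by (intro finite_measure_mono) auto
  also have "\<dots> \<le> 0" using measure_Un_le[OF m] 1 2 by simp
  finally show ?thesis by (simp add: measure_le_0_iff)
qed

lemma compact_polar_params: "compact polar_params"
  unfolding polar_params_def by (intro compact_Times) auto

lemma polar_params_memI: "u \<in> outer_directions x \<Longrightarrow> (1 / (1 + norm x), u) \<in> polar_params"
  by (auto simp: polar_params_def outer_directions_def)

text \<open>Uniform continuity of \<open>polar_mass\<close> on the compact parameter space gives a
  \<open>\<delta>\<close> independent of the direction, so the estimate survives the infimum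
  although the admissible directions vary with the point.\<close>

lemma continuous_on_polar_depth:
  assumes P: "prob_space P" "sets P = sets borel" and rad: "atomless (radial_distr P)"
    and hyp: "\<And>u. u \<in> sphere 0 1 \<Longrightarrow> measure P (hyperplane0 u) = 0"
  shows "continuous_on (- {0}) (\<lambda>x. polar_depth x P)"
proof -
  have "continuous_on polar_params (polar_mass P)"
    unfolding polar_mass_def[abs_def]
    by (rule continuous_on_measure_superlevel[OF P continuous_on_polar_gap polar_gap_lipschitz
          polar_gap_null[OF P rad hyp]])
  then have unif: "uniformly_continuous_on polar_params (polar_mass P)"
    by (rule compact_uniformly_continuous) (rule compact_polar_params)
  have "((\<lambda>x. polar_depth x P) \<longlongrightarrow> polar_depth x P) (nhds x)" if x: "x \<noteq> 0" for x
  proof (rule tendstoI)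
    fix e :: real assume e: "e > 0"
    obtain \<delta> where \<delta>: "\<delta> > 0" "\<And>p q. p \<in> polar_params \<Longrightarrow> q \<in> polar_params \<Longrightarrow> dist p q < \<delta> \<Longrightarrow>
        dist (polar_mass P p) (polar_mass P q) < e / 2"
      using unif half_gt_zero[OF e] unfolding uniformly_continuous_on_def by metis
    \<comment> \<open>A one-sided estimate, used twice below with the two points exchanged.\<close>
    have close: "polar_depth b P \<le> polar_depth a P + e / 2"
      if "a \<noteq> 0" "b \<noteq> 0" "dist b a < norm b" "2 * dist b a / norm b < \<delta> / 2" "dist b a < \<delta> / 2" for a b
    proof -
      have "polar_depth b P - e / 2 \<le> polar_depth a P"
        unfolding polar_depth_altdef[of a]
      proof (rule cINF_greatest[OF outer_directions_nonempty[OF that(1)]])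
        fix u assume u: "u \<in> outer_directions a"
        have "polar_depth b P \<le> polar_mass P (1 / (1 + norm a), u) + e / 2"
        proof (rule polar_depth_le_near[OF u that(2-)])
          fix v assume v: "v \<in> outer_directions b"
            "dist (1 / (1 + norm b), v) (1 / (1 + norm a), u) < \<delta>"
          show "polar_mass P (1 / (1 + norm b), v) \<le> polar_mass P (1 / (1 + norm a), u) + e / 2"
            using \<delta>(2)[OF polar_params_memI[OF v(1)] polar_params_memI[OF u] v(2)]
            unfolding dist_real_def by linarith
        qed
        then show "polar_depth b P - e / 2 \<le> polar_mass P (1 / (1 + norm a), u)" by simp
      qed
      then show ?thesis by simp
    qed
    show "\<forall>\<^sub>F x' in nhds x. dist (polar_depth x' P) (polar_depth x P) < e"
      using eventually_close_nonzero[OF x \<delta>(1)]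
    proof eventually_elim
      case (elim x')
      then have "polar_depth x' P \<le> polar_depth x P + e / 2" "polar_depth x P \<le> polar_depth x' P + e / 2"
        using x by (auto intro!: close simp: dist_commute)
      then show ?case using e by (simp add: dist_real_def)
    qed
  qed
  then show ?thesis
    unfolding continuous_on_def by (blast intro: tendsto_mono[OF at_within_le_nhds])
qed

section \<open>Invariance, monotonicity along rays and vanishing at infinity\<close>

text \<open>An isometry maps the admissible directions at \<open>x\<close> onto those at
  \<open>f x\<close>, and pulling back the region of \<open>f u\<close> gives the region of
  \<open>u\<close>; the two infima run over the same values.\<close>

lemma polar_depth_orthogonal:
  fixes f :: "'a::euclidean_space \<Rightarrow> 'a"
  assumes P: "sets P = sets borel" and f: "orthogonal_transformation f"
  shows "polar_depth (f x) (distr P borel f) = polar_depth x P"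
proof -
  have fi: "f a \<bullet> f b = a \<bullet> b" for a b using f by (auto simp: orthogonal_transformation_def)
  have fn: "norm (f a) = norm a" for a by (simp add: norm_eq_sqrt_inner fi)
  have "f \<in> borel_measurable P"
    using f unfolding measurable_cong_sets[OF P refl]
    by (intro borel_measurable_continuous_onI linear_continuous_on)
      (simp add: orthogonal_transformation_def linear_conv_bounded_linear)
  then have mass: "measure (distr P borel f) {y. norm (f x) \<le> norm y \<and> y \<in> halfspace0 (f u)}
      = measure P {y. norm x \<le> norm y \<and> y \<in> halfspace0 u}" for u
    using sets_eq_imp_space_eq[OF P]
    by (subst measure_distr) (auto simp: borel_closed closed_polar_region fn fi halfspace0_def
        intro!: arg_cong[where f="measure P"])
  have "outer_directions (f x) = f ` outer_directions x"
  proof (rule set_eqI)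
    fix v
    obtain u where "v = f u" using orthogonal_transformation_surj[OF f] by blast
    then show "v \<in> outer_directions (f x) \<longleftrightarrow> v \<in> f ` outer_directions x"
      using orthogonal_transformation_inj[OF f]
      by (auto simp: outer_directions_def halfspace0_def fi fn inj_image_mem_iff)
  qed
  then show ?thesis
    by (simp add: polar_depth_altdef polar_mass_radius mass image_image)
qed

text \<open>Along a ray the admissible directions stay the same while the regions shrink. The cases
  \<open>s = 1\<close> and \<open>t = 1\<close> give the two monotonicity claims.\<close>

lemma polar_depth_antimono_scaleR:
  assumes P: "prob_space P" "sets P = sets borel" and x: "x \<noteq> 0" and t: "0 < s" "s \<le> t"
  shows "polar_depth (t *\<^sub>R x) P \<le> polar_depth (s *\<^sub>R x) P"
proof -
  interpret prob_space P by fact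
  show ?thesis
    unfolding polar_depth_altdef polar_mass_radius using outer_directions_nonempty[OF x] t
    by (intro cINF_mono) (auto simp: outer_directions_scaleR P borel_closed closed_polar_region
        intro!: finite_measure_mono bexI elim!: order_trans[rotated] mult_right_mono)
qed

text \<open>The depth is at most the mass outside the open ball of radius \<open>norm x\<close>. In
  the parameter \<open>s = 1 / (1 + r)\<close> this mass is 0 at \<open>s = 0\<close>, and the local
  upper bound there makes it small for large radii.\<close>

lemma polar_depth_tendsto_0_at_infinity:
  fixes P :: "'a::euclidean_space measure"
  assumes P: "prob_space P" "sets P = sets borel"
  shows "((\<lambda>x. polar_depth x P) \<longlongrightarrow> 0) at_infinity"
proof (rule tendstoI)
  fix e :: real assume e: "e > 0"
  interpret prob_space P by fact
  let ?G = "\<lambda>s y::'a. s - 1 / (1 + norm y)"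
  have cont: "continuous_on UNIV (?G s)" for s by (intro continuous_intros) simp
  have lip: "\<bar>?G s y - ?G t y\<bar> \<le> dist s t" for s t y by (simp add: dist_real_def)
  have empty: "{y. 0 \<le> ?G 0 y} = {}" by (auto simp: not_le)
  have ev: "\<forall>\<^sub>F s in nhds 0. measure P {y. 0 \<le> ?G s y} < e"
    using eventually_measure_superlevel_less_nhds[where G="?G" and p=0, OF P cont lip e] empty by simp
  have "((\<lambda>x::'a. 1 / (1 + norm x)) \<longlongrightarrow> 0) at_infinity"
    by (rule tendsto_divide_0[OF tendsto_const])
      (intro filterlim_at_top_imp_at_infinity filterlim_tendsto_add_at_top[OF tendsto_const] filterlim_norm_at_top)
  from eventually_compose_filterlim[OF ev this] eventually_not_equal_at_infinity[of 0]
  show "\<forall>\<^sub>F x in at_infinity. dist (polar_depth x P) 0 < e"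
  proof eventually_elim
    case (elim x)
    obtain u where u: "u \<in> outer_directions x" using outer_directions_nonempty[OF elim(2)] by blast
    have "polar_depth x P \<le> polar_mass P (1 / (1 + norm x), u)"
      unfolding polar_depth_altdef by (intro cINF_lower u) simp
    also have "\<dots> \<le> measure P {y. 0 \<le> ?G (1 / (1 + norm x)) y}"
      unfolding polar_mass_def
    proof (rule finite_measure_mono)
      have "closed {y. 0 \<le> ?G (1 / (1 + norm x)) y}"
        by (intro closed_Collect_le continuous_intros) simp
      then show "{y. 0 \<le> ?G (1 / (1 + norm x)) y} \<in> events" by (simp add: P(2) borel_closed)
    qed (auto simp: polar_gap_def)
    finally have "polar_depth x P < e" using elim(1) by linarith
    moreover have "0 \<le> polar_depth x P"
      unfolding polar_depth_altdef polar_mass_def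
      using outer_directions_nonempty[OF elim(2)] by (intro cINF_greatest) auto
    ultimately show ?case by simp
  qed
qed

section \<open>Continuity in the measure\<close>

text \<open>At a fixed \<open>x\<close> both depths are infima over the same directions, so uniform
  closeness of the masses passes to the depths with an error independent of
  \<open>x\<close>.\<close>

lemma polar_depth_uniform_limit:
  fixes P :: "'a::euclidean_space measure"
  assumes P: "prob_space P" "sets P = sets borel" and rad: "atomless (radial_distr P)"
    and hyp: "\<And>u. u \<in> sphere 0 1 \<Longrightarrow> measure P (hyperplane0 u) = 0"
    and \<pi>: "\<And>n. prob_space (\<pi> n)" "\<And>n. sets (\<pi> n) = sets borel"
    and weak: "weakly_converges \<pi> P"
  shows "(\<lambda>n. SUP x \<in> - {0}. \<bar>polar_depth x P - polar_depth x (\<pi> n)\<bar>) \<longlonglongrightarrow> 0"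
proof (rule tendstoI)
  fix e :: real assume e: "e > 0"
  have "\<forall>\<^sub>F n in sequentially. \<forall>p\<in>polar_params. \<bar>polar_mass (\<pi> n) p - polar_mass P p\<bar> < e / 2"
    unfolding polar_mass_def
    by (rule uniform_measure_superlevel[OF \<pi> P weak continuous_on_polar_gap polar_gap_lipschitz
          compact_polar_params polar_gap_null[OF P rad hyp] half_gt_zero[OF e]])
  then show "\<forall>\<^sub>F n in sequentially.
      dist (SUP x \<in> - {0}. \<bar>polar_depth x P - polar_depth x (\<pi> n)\<bar>) 0 < e"
  proof eventually_elim
    case (elim n)
    have le: "\<bar>polar_depth x P - polar_depth x (\<pi> n)\<bar> \<le> e / 2" if x: "x \<noteq> 0" for x
    proof -
      have *: "\<bar>polar_mass (\<pi> n) (1 / (1 + norm x), u) - polar_mass P (1 / (1 + norm x), u)\<bar> < e / 2"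
        if "u \<in> outer_directions x" for u
        using elim polar_params_memI[OF that] by blast
      have "polar_depth x P \<le> polar_depth x (\<pi> n) + e / 2"
        unfolding polar_depth_altdef using outer_directions_nonempty[OF x]
      proof (rule INF_le_INF_add)
        fix u assume u: "u \<in> outer_directions x"
        show "\<exists>v\<in>outer_directions x. polar_mass P (1 / (1 + norm x), v)
            \<le> polar_mass (\<pi> n) (1 / (1 + norm x), u) + e / 2"
          using *[OF u] by (intro bexI[OF _ u]) linarith
      qed simp
      moreover have "polar_depth x (\<pi> n) \<le> polar_depth x P + e / 2"
        unfolding polar_depth_altdef using outer_directions_nonempty[OF x]
      proof (rule INF_le_INF_add)
        fix u assume u: "u \<in> outer_directions x"
        show "\<exists>v\<in>outer_directions x. polar_mass (\<pi> n) (1 / (1 + norm x), v)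
            \<le> polar_mass P (1 / (1 + norm x), u) + e / 2"
          using *[OF u] by (intro bexI[OF _ u]) linarith
      qed simp
      ultimately show ?thesis by linarith
    qed
    \<comment> \<open>The real supremum is controlled only over a nonempty family that is bounded
      above; a basis vector witnesses nonemptiness.\<close>
    obtain b :: 'a where "b \<in> Basis" using nonempty_Basis by blast
    then have b: "b \<in> - {0}" using nonzero_Basis by blast
    have "(SUP x \<in> - {0}. \<bar>polar_depth x P - polar_depth x (\<pi> n)\<bar>) \<le> e / 2"
      using b le by (intro cSUP_least) auto
    moreover have "0 \<le> (SUP x \<in> - {0}. \<bar>polar_depth x P - polar_depth x (\<pi> n)\<bar>)"
    proof (rule cSUP_upper2[OF _ b])
      show "bdd_above ((\<lambda>x. \<bar>polar_depth x P - polar_depth x (\<pi> n)\<bar>) ` (- {0}))"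
        by (rule bdd_aboveI2[of _ _ "e / 2"]) (use le in blast)
    qed simp
    ultimately show ?case using e by simp
  qed
qed

section \<open>The limit at the origin along rays\<close>

text \<open>For every direction, the region at radius \<open>r\<close> differs from the punctured
  halfspace only inside the punctured ball of radius \<open>r\<close>. The mass of that ball bounds
  the error uniformly in the direction and tends to 0.\<close>

lemma polar_depth_tendsto_angular_depth:
  fixes P :: "'a::euclidean_space measure"
  assumes P: "prob_space P" "sets P = sets borel" "measure P (- {0}) > 0"
    and x: "x \<noteq> 0" and t: "\<And>n. t n > 0" "t \<longlonglongrightarrow> 0"
  shows "(\<lambda>n. polar_depth (t n *\<^sub>R x) P)
    \<longlonglongrightarrow> measure (radial_distr P) {0<..} * angular_depth (direction x) (angular_distr P)"
proof -
  interpret prob_space P by (rule P)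
  have sp: "space P = UNIV" using sets_eq_imp_space_eq[OF P(2)] by simp
  have norm_meas: "norm \<in> borel_measurable P" by (simp add: measurable_cong_sets[OF P(2) refl])
  interpret R: real_distribution "radial_distr P"
    unfolding radial_distr_def using norm_meas by (rule real_distribution_distr)
  have rad: "measure (radial_distr P) A = measure P (norm -` A)" if "A \<in> sets borel" for A
    unfolding radial_distr_def using norm_meas that by (simp add: measure_distr sp)
  \<comment> \<open>The origin is removed because no region of positive radius contains it and the
    angular law is conditioned on avoiding it.\<close>
  define H where "H u = {y. y \<noteq> 0 \<and> y \<in> halfspace0 u}" for u :: 'a
  have pos: "measure (radial_distr P) {0<..} = measure P (- {0})"
    by (simp add: rad) (rule arg_cong[where f="measure P"], auto)
  have hb: "halfspace0 u \<in> sets borel" for u :: 'a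
    unfolding halfspace0_def by (intro borel_closed closed_Collect_le continuous_intros)
  then have Hm: "H u \<in> events" for u
  proof -
    have "H u = halfspace0 u - {0}" by (auto simp: H_def)
    then show ?thesis using hb[of u] by (simp add: P(2))
  qed
  have ang: "measure (angular_distr P) (sphere 0 1 \<inter> halfspace0 u) = measure P (H u) / measure P (- {0})"
    for u
  proof -
    have "sphere 0 1 \<inter> halfspace0 u \<in> sets borel" using hb[of u] by auto
    moreover have "{y. y \<noteq> 0 \<and> direction y \<in> sphere 0 1 \<inter> halfspace0 u} = H u"
      by (auto simp: H_def direction_def halfspace0_def zero_le_mult_iff)
    ultimately show ?thesis using measure_angular_distr(1)[OF P, of "sphere 0 1 \<inter> halfspace0 u"] by simp
  qed
  have dir: "{u \<in> sphere 0 1. direction x \<in> halfspace0 u} = outer_directions x"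
    using x outer_directions_scaleR[of "inverse (norm x)" x]
    by (simp add: direction_def outer_directions_def)
  note ne = outer_directions_nonempty[OF x]
  let ?L = "measure (radial_distr P) {0<..} * angular_depth (direction x) (angular_distr P)"
  \<comment> \<open>Multiplication by a nonnegative constant is monotone and continuous, hence
    commutes with the infimum; the normalising constant of \<open>angular_distr\<close> then
    cancels.\<close>
  have L: "?L = (INF u\<in>outer_directions x. measure P (H u))"
  proof -
    have "?L = (INF u\<in>outer_directions x. measure P (- {0}) * (measure P (H u) / measure P (- {0})))"
      unfolding angular_depth_def dir ang pos
      by (subst continuous_at_Inf_mono[where f="\<lambda>z. measure P (- {0}) * z"])
        (use ne in \<open>auto simp: image_image mono_def divide_right_mono mult_left_mono
           intro!: bdd_belowI2[of _ 0] continuous_intros\<close>)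
    then show ?thesis using P(3) by simp
  qed
  define r where "r n = t n * norm x" for n
  have r: "r n > 0" for n using t x by (simp add: r_def)
  have "r \<longlonglongrightarrow> 0" unfolding r_def using tendsto_mult_right[OF t(2), of "norm x"] by simp
  then have "filterlim r (at_right 0) sequentially" using r less_imp_neq[OF r, symmetric] by (simp add: filterlim_at)
  moreover have "((cdf (radial_distr P)) \<longlongrightarrow> cdf (radial_distr P) 0) (at_right 0)"
    using R.cdf_is_right_cont by (simp add: continuous_within)
  ultimately have "(\<lambda>n. cdf (radial_distr P) (r n)) \<longlonglongrightarrow> cdf (radial_distr P) 0"
    by (rule filterlim_compose[rotated])
  \<comment> \<open>Subtracting the value at 0 removes a possible atom at the origin, so the
    difference is the mass of the punctured ball; right-continuity of the distribution function
    gives the limit.\<close>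
  then have lim: "(\<lambda>n. cdf (radial_distr P) (r n) - cdf (radial_distr P) 0) \<longlonglongrightarrow> 0"
    by (simp add: LIM_zero)
  have near: "norm (polar_depth (t n *\<^sub>R x) P - ?L) \<le> cdf (radial_distr P) (r n) - cdf (radial_distr P) 0" for n
  proof -
    define d where "d = cdf (radial_distr P) (r n) - cdf (radial_distr P) 0"
    define S where "S u = {y. r n \<le> norm y \<and> y \<in> halfspace0 u}" for u :: 'a
    have d: "d = measure P (norm -` {0<..r n})"
      unfolding d_def using R.cdf_diff_eq[OF r[of n]] by (simp add: rad)
    have Sm: "S u \<in> events" for u unfolding S_def P(2) by (intro borel_closed closed_polar_region)
    have Nm: "norm -` {0<..r n} \<in> events"
      using measurable_sets[OF norm_meas, of "{0<..r n}"] by (simp add: sp)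
    have pd: "polar_depth (t n *\<^sub>R x) P = (INF u\<in>outer_directions x. measure P (S u))"
      using t(1)[of n] unfolding polar_depth_altdef polar_mass_radius S_def r_def
      by (simp add: outer_directions_scaleR abs_of_pos)
    have SH: "measure P (S u) \<le> measure P (H u)" for u
      using r[of n] by (intro finite_measure_mono Hm) (auto simp: S_def H_def)
    have HS: "measure P (H u) \<le> measure P (S u) + d" for u
    proof -
      have "measure P (H u) \<le> measure P (S u \<union> norm -` {0<..r n})"
        using Sm Nm by (intro finite_measure_mono) (auto simp: S_def H_def)
      also have "\<dots> \<le> measure P (S u) + d" unfolding d by (rule measure_Un_le[OF Sm Nm])
      finally show ?thesis .
    qed
    have "(INF u\<in>outer_directions x. measure P (S u)) \<le> (INF u\<in>outer_directions x. measure P (H u)) + 0"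
      by (rule INF_le_INF_add[OF ne]) (use SH in auto)
    moreover have "(INF u\<in>outer_directions x. measure P (H u)) \<le> (INF u\<in>outer_directions x. measure P (S u)) + d"
      by (rule INF_le_INF_add[OF ne]) (use HS in auto)
    moreover have "0 \<le> d" unfolding d by simp
    ultimately show ?thesis unfolding L pd d_def[symmetric] by simp
  qed
  show ?thesis
    by (rule LIM_zero_cancel, rule Lim_null_comparison[OF always_eventually[OF allI] lim], rule near)
qed

text \<open>The limsup is taken in the extended reals, where it always exists. Boundaries of affine
  halfspaces are the sets \<open>{y. y \<bullet> u = c}\<close> with unit \<open>u\<close>;
  \<open>c = 0\<close> gives the hyperplanes through the origin.\<close>

theorem proposition3p1:
  fixes P :: "(real ^ 'n) measure"
  assumes "CARD('n) \<ge> 2"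
    and "prob_space P" and "sets P = sets borel"
    and "measure P (- {0}) > 0"
  shows
    "(\<forall>A :: real ^ 'n ^ 'n. \<forall>x. orthogonal_matrix A \<and> x \<noteq> 0 \<longrightarrow>
        polar_depth x P = polar_depth (A *v x) (distr P borel (\<lambda>y. A *v y)))
   \<and> (\<forall>x. x \<noteq> 0 \<longrightarrow>
        (\<forall>t\<ge>1. polar_depth (t *\<^sub>R x) P \<le> polar_depth x P) \<and>
        (\<forall>t. 0 < t \<and> t \<le> 1 \<longrightarrow> polar_depth x P \<le> polar_depth (t *\<^sub>R x) P))
   \<and> ((\<forall>u \<in> sphere 0 1. measure P (hyperplane0 u) = 0) \<longrightarrow>
        (\<forall>x (t :: nat \<Rightarrow> real). x \<noteq> 0 \<and> (\<forall>n. t n > 0) \<and> t \<longlonglongrightarrow> 0 \<longrightarrow>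
          (\<lambda>n. polar_depth (t n *\<^sub>R x) P)
            \<longlonglongrightarrow> measure (radial_distr P) {0<..} * angular_depth (direction x) (angular_distr P)))
   \<and> ((\<lambda>x. polar_depth x P) \<longlongrightarrow> 0) at_infinity
   \<and> (atomless (radial_distr P) \<longrightarrow>
        (\<forall>x (X :: nat \<Rightarrow> real ^ 'n). x \<noteq> 0 \<and> (\<forall>n. X n \<noteq> 0) \<and> X \<longlonglongrightarrow> x \<longrightarrow>
          limsup (\<lambda>n. ereal (polar_depth (X n) P)) \<le> ereal (polar_depth x P)))
   \<and> (atomless (radial_distr P) \<and> (\<forall>u \<in> sphere 0 1. measure P (hyperplane0 u) = 0) \<longrightarrow>
        continuous_on (- {0}) (\<lambda>x. polar_depth x P))
   \<and> ((\<forall>u \<in> sphere 0 1. \<forall>c. measure P {y. y \<bullet> u = c} = 0) \<and> atomless (radial_distr P) \<longrightarrow>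
        (\<forall>\<pi> :: nat \<Rightarrow> (real ^ 'n) measure.
          (\<forall>n. prob_space (\<pi> n) \<and> sets (\<pi> n) = sets borel) \<and> weakly_converges \<pi> P \<longrightarrow>
          (\<lambda>n. SUP x \<in> - {0}. \<bar>polar_depth x P - polar_depth x (\<pi> n)\<bar>) \<longlonglongrightarrow> 0))"
proof (intro conjI allI impI)
  note P = assms(2,3)
  fix A :: "real ^ 'n ^ 'n" and x :: "real ^ 'n"
  assume "orthogonal_matrix A \<and> x \<noteq> 0"
  then have "orthogonal_transformation ((*v) A)"
    by (simp add: orthogonal_transformation_matrix)
  from polar_depth_orthogonal[OF P(2) this]
  show "polar_depth x P = polar_depth (A *v x) (distr P borel (\<lambda>y. A *v y))" by simp
next
  fix x :: "real ^ 'n" and t :: real assume "x \<noteq> 0" "1 \<le> t"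
  then show "polar_depth (t *\<^sub>R x) P \<le> polar_depth x P"
    using polar_depth_antimono_scaleR[OF assms(2,3), of x 1 t] by simp
next
  fix x :: "real ^ 'n" and t :: real assume "x \<noteq> 0" "0 < t \<and> t \<le> 1"
  then show "polar_depth x P \<le> polar_depth (t *\<^sub>R x) P"
    using polar_depth_antimono_scaleR[OF assms(2,3), of x t 1] by simp
next
  fix x :: "real ^ 'n" and t :: "nat \<Rightarrow> real"
  assume "x \<noteq> 0 \<and> (\<forall>n. t n > 0) \<and> t \<longlonglongrightarrow> 0"
  then show "(\<lambda>n. polar_depth (t n *\<^sub>R x) P)
      \<longlonglongrightarrow> measure (radial_distr P) {0<..} * angular_depth (direction x) (angular_distr P)"
    by (intro polar_depth_tendsto_angular_depth assms) auto
next
  show "((\<lambda>x. polar_depth x P) \<longlongrightarrow> 0) at_infinity"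
    by (rule polar_depth_tendsto_0_at_infinity[OF assms(2,3)])
next
  fix x and X :: "nat \<Rightarrow> real ^ 'n"
  assume X: "x \<noteq> 0 \<and> (\<forall>n. X n \<noteq> 0) \<and> X \<longlonglongrightarrow> x"
  show "limsup (\<lambda>n. ereal (polar_depth (X n) P)) \<le> ereal (polar_depth x P)"
  proof (rule ereal_le_epsilon2)
    fix e :: real assume "e > 0"
    from eventually_compose_filterlim[OF polar_depth_upper_semicontinuous[OF assms(2,3) _ this]] X
    have "\<forall>\<^sub>F n in sequentially. polar_depth (X n) P \<le> polar_depth x P + e" by blast
    then show "limsup (\<lambda>n. ereal (polar_depth (X n) P)) \<le> ereal (polar_depth x P) + ereal e"
      by (intro Limsup_bounded) (auto elim: eventually_mono)
  qed
next
  assume "atomless (radial_distr P) \<and> (\<forall>u \<in> sphere 0 1. measure P (hyperplane0 u) = 0)"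
  then show "continuous_on (- {0}) (\<lambda>x. polar_depth x P)"
    by (intro continuous_on_polar_depth assms) auto
next
  fix \<pi> :: "nat \<Rightarrow> (real ^ 'n) measure"
  assume "(\<forall>u \<in> sphere 0 1. \<forall>c. measure P {y. y \<bullet> u = c} = 0) \<and> atomless (radial_distr P)"
    and "(\<forall>n. prob_space (\<pi> n) \<and> sets (\<pi> n) = sets borel) \<and> weakly_converges \<pi> P"
  then show "(\<lambda>n. SUP x \<in> - {0}. \<bar>polar_depth x P - polar_depth x (\<pi> n)\<bar>) \<longlonglongrightarrow> 0"
    by (intro polar_depth_uniform_limit assms) (auto simp: hyperplane0_def)
qed

end
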